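(* Let $V_n(x,s,q)=\begin{pmatrix} q^nx & q^n(x^2+qs)\\ 1 & x\end{pmatrix}$. Then for all integers $n\ge 1$ $$\begin{pmatrix} T_n(x,s,q) & (x^2+qs)\,U_{n-1}(x,q^2s,q)\\ U_{n-1}(x,qs,q) & T_n(x,qs,q)\end{pmatrix}=V_0(x,s,q)\,V_1(x,s,q)\cdots V_{n-1}(x,s,q).$$
   Context: Here $x,s,q$ are indeterminates. Notation: $(a;q)_n=\prod_{j=0}^{n-1}(1-q^ja)$; $\begin{bmatrix} n\\k\end{bmatrix}=\frac{(q;q)_n}{(q;q)_k(q;q)_{n-k}}$ for $0\le k\le n$; $[n]=\frac{1-q^n}{1-q}$. The $q$-Chebyshev polynomials of the second kind are, for $n\ge0$, $$U_n(x,s,q)=\sum_{k=0}^{\lfloor n/2\rfloor}q^{k^2}\begin{bmatrix} n-k\\k\end{bmatrix}(1+q^{k+1})\cdots(1+q^{n-k})\,s^kx^{n-2k}.$$ The $q$-Chebyshev polynomials of the first kind are $T_0(x,s,q)=1$ and, for $n>0$, $$T_n(x,s,q)=\sum_{k=0}^{\lfloor n/2\rfloor}q^{k^2}\frac{[n]}{[n-k]}\begin{bmatrix} n-k\\k\end{bmatrix}\frac{(-q;q)_{n-1}}{(-q;q)_k\,(-q^{n-k};q)_k}\,s^kx^{n-2k}.$$ *)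

theory Defs
  imports
    "HOL-Analysis.Cartesian_Space"
    "HOL-Computational_Algebra.Polynomial_Factorial"
begin

text \<open>
  Field of rational functions over an arbitrary coefficient field in three independent
  indeterminates: the innermost polynomial variable is \<open>q\<close>, the middle one \<open>s\<close>, the outermost
  one \<open>x\<close>.
\<close>

type_synonym 'k ratfun3 = "'k poly poly poly fract"

definition indet_q :: "'k::field ratfun3" where
  "indet_q = to_fract [:[:[:0, 1:]:]:]"

definition indet_s :: "'k::field ratfun3" where
  "indet_s = to_fract [:[:0, 1:]:]"

definition indet_x :: "'k::field ratfun3" where
  "indet_x = to_fract [:0, 1:]"

text \<open>
  The following formulas are stated for elements of any field, so that substitutions such as
  \<open>s \<mapsto> q s\<close> are just applications to other arguments. They carry their intended meaning when
  no denominator vanishes, in particular when \<open>q\<close> is not a root of unity.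
\<close>

definition qpoch :: "'a::field \<Rightarrow> 'a \<Rightarrow> nat \<Rightarrow> 'a" where
  "qpoch a q n = (\<Prod>j<n. 1 - q ^ j * a)"

text \<open>Only meant for \<open>k \<le> n\<close>: the subtraction is truncated.\<close>

definition qbinom :: "'a::field \<Rightarrow> nat \<Rightarrow> nat \<Rightarrow> 'a" where
  "qbinom q n k = qpoch q q n / (qpoch q q k * qpoch q q (n - k))"

definition qbracket :: "'a::field \<Rightarrow> nat \<Rightarrow> 'a" where
  "qbracket q n = (1 - q ^ n) / (1 - q)"

definition qcheb_U :: "nat \<Rightarrow> 'a::field \<Rightarrow> 'a \<Rightarrow> 'a \<Rightarrow> 'a" where
  "qcheb_U n x s q =
     (\<Sum>k = 0..n div 2.
        q ^ (k\<^sup>2) * qbinom q (n - k) k * (\<Prod>j = k + 1..n - k. 1 + q ^ j) * s ^ k * x ^ (n - 2 * k))"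

definition qcheb_T :: "nat \<Rightarrow> 'a::field \<Rightarrow> 'a \<Rightarrow> 'a \<Rightarrow> 'a" where
  "qcheb_T n x s q =
     (if n = 0 then 1
      else \<Sum>k = 0..n div 2.
        q ^ (k\<^sup>2) * (qbracket q n / qbracket q (n - k)) * qbinom q (n - k) k *
        (qpoch (- q) q (n - 1) / (qpoch (- q) q k * qpoch (- (q ^ (n - k))) q k)) *
        s ^ k * x ^ (n - 2 * k))"

definition mat22 :: "'a::zero \<Rightarrow> 'a \<Rightarrow> 'a \<Rightarrow> 'a \<Rightarrow> 'a^2^2" where
  "mat22 a b c d = vector [vector [a, b], vector [c, d]]"

definition V :: "nat \<Rightarrow> 'a::field \<Rightarrow> 'a \<Rightarrow> 'a \<Rightarrow> 'a^2^2" where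
  "V n x s q = mat22 (q ^ n * x) (q ^ n * (x\<^sup>2 + q * s)) 1 x"

text \<open>The matrix product \<open>A 0 ** A 1 ** \<dots> ** A (n - 1)\<close>, in this order.\<close>

definition mat_prod :: "(nat \<Rightarrow> 'a::semiring_1^'m^'m) \<Rightarrow> nat \<Rightarrow> 'a^'m^'m" where
  "mat_prod A n = foldr (**) (map A [0..<n]) (mat 1)"

end

theory Submission
  imports Defs
begin

text \<open>
  Multiplying the claimed matrix for \<open>n\<close> by \<open>V n x s q\<close> on the right gives the claimed matrix for
  \<open>n + 1\<close> as soon as four contiguity relations between \<open>T\<close> and \<open>U\<close> hold (the lemmas
  \<open>qcheb_U_Suc\<close>, \<open>qcheb_U_Suc_shifted\<close>, \<open>qcheb_T_Suc_Suc\<close> and \<open>qcheb_T_Suc_Suc_shifted\<close>); the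
  theorem then follows by induction from \<open>n = 1\<close>.

  Because \<open>(q;q)\<^sub>m (-q;q)\<^sub>m = (q\<^sup>2;q\<^sup>2)\<^sub>m\<close>, the coefficient of \<open>s\<^sup>k x\<^sup>r\<close> in \<open>U\<^sub>n\<close>, where \<open>n = 2k + r\<close>,
  is the single quotient
  \<open>w k r = q^(k\<^sup>2) (q\<^sup>2;q\<^sup>2)\<^bsub>k+r\<^esub> / ((q\<^sup>2;q\<^sup>2)\<^sub>k (q;q)\<^sub>r)\<close>,
  and for \<open>n > 0\<close> the one in \<open>T\<^sub>n\<close> is \<open>w k r (1 - q^(2k+r)) / (1 - q^(2k+2r))\<close>. Multiplication by \<open>x\<close>
  shifts \<open>r\<close>, multiplication by \<open>s\<close> shifts \<open>k\<close>, and
  \<open>(1 - q^(2k+2r)) w k (r-1) = (1 - q^r) w k r\<close>,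
  \<open>(1 - q^(2k+2r)) q^(2k-1) w (k-1) r = (1 - q^(2k)) w k r\<close>.
  Comparing coefficients and dropping the factor \<open>w k r / (1 - q^(2k+2r))\<close> reduces the relations to
  \<open>1 - q^(2k+2r) = q^(2k+r) (1 - q^r) + (1 - q^(2k+r))\<close>,
  \<open>q^(2k) (1 - q^(2k+2r)) = q^(2k+r) (1 - q^(2k+r)) + q^(2k) (1 - q^r)\<close>,
  \<open>1 - q^(2k+r) = (1 - q^r) + q^r (1 - q^(2k))\<close> and
  \<open>1 - q^(2k+r) = q^(2k) (1 - q^r) + (1 - q^(2k))\<close>.
  All this holds in any field in which no positive power of \<open>q\<close> equals \<open>1\<close>.
\<close>

section \<open>Weighted homogeneous polynomials\<close>

text \<open>
  The polynomial \<open>\<Sum> c k r s\<^sup>k x\<^sup>r\<close> over all \<open>k, r\<close> with \<open>2k + r = n\<close>. Indexing the coefficients by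
  both exponents makes the multiplications by \<open>x\<close> and \<open>s\<close> plain index shifts.
\<close>

definition whom :: "nat \<Rightarrow> (nat \<Rightarrow> nat \<Rightarrow> 'a::field) \<Rightarrow> 'a \<Rightarrow> 'a \<Rightarrow> 'a" where
  "whom n c x s = (\<Sum>k\<le>n div 2. c k (n - 2 * k) * s ^ k * x ^ (n - 2 * k))"

lemma whom_cong:
  assumes "\<And>k r. 2 * k + r = n \<Longrightarrow> c k r = d k r"
  shows "whom n c x s = whom n d x s"
  unfolding whom_def by (intro sum.cong) (auto simp: assms)

lemma whom_add: "whom n c x s + whom n d x s = whom n (\<lambda>k r. c k r + d k r) x s"
  by (simp add: whom_def sum.distrib algebra_simps)

lemma whom_scale: "a * whom n c x s = whom n (\<lambda>k r. a * c k r) x s"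
  by (simp add: whom_def sum_distrib_left algebra_simps)

lemma whom_scale_arg: "whom n c x (a * s) = whom n (\<lambda>k r. a ^ k * c k r) x s"
  by (simp add: whom_def power_mult_distrib algebra_simps)

lemma whom_mult_x:
  "x * whom n c x s = whom (Suc n) (\<lambda>k r. case r of 0 \<Rightarrow> 0 | Suc r' \<Rightarrow> c k r') x s"
  unfolding whom_def sum_distrib_left
proof (rule sum.mono_neutral_cong_left)
  show "\<forall>k\<in>{..Suc n div 2} - {..n div 2}.
      (case Suc n - 2 * k of 0 \<Rightarrow> 0 | Suc r' \<Rightarrow> c k r') * s ^ k * x ^ (Suc n - 2 * k) = 0"
  proof
    fix k assume "k \<in> {..Suc n div 2} - {..n div 2}"
    then have "Suc n - 2 * k = 0" by auto
    then show "(case Suc n - 2 * k of 0 \<Rightarrow> 0 | Suc r' \<Rightarrow> c k r') * s ^ k * x ^ (Suc n - 2 * k) = 0"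
      by (simp only: nat.case mult_zero_left)
  qed
  fix k assume "k \<in> {..n div 2}"
  then have "Suc n - 2 * k = Suc (n - 2 * k)" by auto
  then show "x * (c k (n - 2 * k) * s ^ k * x ^ (n - 2 * k)) =
      (case Suc n - 2 * k of 0 \<Rightarrow> 0 | Suc r' \<Rightarrow> c k r') * s ^ k * x ^ (Suc n - 2 * k)"
    by (simp add: algebra_simps)
qed auto

lemma whom_mult_s:
  "s * whom n c x s = whom (Suc (Suc n)) (\<lambda>k r. case k of 0 \<Rightarrow> 0 | Suc k' \<Rightarrow> c k' r) x s"
proof -
  have "Suc (Suc n) div 2 = Suc (n div 2)" by simp
  then show ?thesis
    unfolding whom_def
    by (simp only: sum.atMost_Suc_shift) (simp add: sum_distrib_left algebra_simps)
qed

section \<open>Coefficients of the q-Chebyshev polynomials\<close>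

lemma qpoch_0 [simp]: "qpoch a q 0 = 1"
  by (simp add: qpoch_def)

lemma qpoch_Suc: "qpoch a q (Suc n) = qpoch a q n * (1 - q ^ n * a)"
  by (simp add: qpoch_def)

lemma qpoch_add: "qpoch a q (m + n) = qpoch a q m * qpoch (q ^ m * a) q n"
  by (induction n) (simp_all add: qpoch_Suc power_add algebra_simps)

lemma qpoch_mult_qpoch_minus: "qpoch q q n * qpoch (- q) q n = qpoch (q\<^sup>2) (q\<^sup>2) n"
proof (induction n)
  case (Suc n)
  have "qpoch q q (Suc n) * qpoch (- q) q (Suc n) =
      (qpoch q q n * qpoch (- q) q n) * ((1 - q ^ n * q) * (1 + q ^ n * q))"
    by (simp add: qpoch_Suc algebra_simps)
  also have "(1 - q ^ n * q) * (1 + q ^ n * q) = 1 - (q\<^sup>2) ^ n * q\<^sup>2"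
    by (simp add: algebra_simps power2_eq_square power_mult_distrib)
  finally show ?case
    by (simp only: Suc qpoch_Suc)
qed simp

lemma qpoch_minus_mult_prod:
  assumes "k \<le> m"
  shows "qpoch (- q) q k * (\<Prod>j = k + 1..m. 1 + q ^ j) = qpoch (- q) q m"
  using assms by (induction m rule: dec_induct) (simp_all add: qpoch_Suc mult.assoc[symmetric])

definition ucoeff :: "'a::field \<Rightarrow> nat \<Rightarrow> nat \<Rightarrow> 'a" where
  "ucoeff q k r =
     q ^ (k\<^sup>2) * qpoch (q\<^sup>2) (q\<^sup>2) (k + r) / (qpoch (q\<^sup>2) (q\<^sup>2) k * qpoch q q r)"

definition tcoeff :: "'a::field \<Rightarrow> nat \<Rightarrow> nat \<Rightarrow> 'a" where
  "tcoeff q k r = ucoeff q k r * (1 - q ^ (2 * k + r)) / (1 - q ^ (2 * k + 2 * r))"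

locale not_root_of_unity =
  fixes q :: "'a::field"
  assumes power_neq_1: "n > 0 \<Longrightarrow> q ^ n \<noteq> 1"
begin

lemma qpoch_q_nz: "qpoch q q n \<noteq> 0"
  using power_neq_1[of "Suc _"] by (auto simp: qpoch_def mult.commute)

lemma qpoch_sq_nz: "qpoch (q\<^sup>2) (q\<^sup>2) n \<noteq> 0"
proof -
  have "1 - (q\<^sup>2) ^ j * q\<^sup>2 \<noteq> 0" for j
    using power_neq_1[of "2 * (j + 1)"] unfolding power_mult by (simp add: mult.commute)
  then show ?thesis by (simp add: qpoch_def)
qed

lemma qpoch_minus_nz: "qpoch (- q) q n \<noteq> 0"
  using qpoch_sq_nz[of n] by (auto simp flip: qpoch_mult_qpoch_minus)

lemma qcheb_U_eq_whom: "qcheb_U n x s q = whom n (ucoeff q) x s"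
  unfolding qcheb_U_def whom_def atLeast0AtMost
proof (rule sum.cong)
  fix k assume "k \<in> {..n div 2}"
  then have le: "k \<le> n - k" and eq: "k + (n - 2 * k) = n - k" "n - k - k = n - 2 * k" by auto
  have "q ^ (k\<^sup>2) * qbinom q (n - k) k * (\<Prod>j = k + 1..n - k. 1 + q ^ j) = ucoeff q k (n - 2 * k)"
    unfolding ucoeff_def qbinom_def eq
    using qpoch_minus_mult_prod[OF le, of q] qpoch_q_nz qpoch_minus_nz[of k]
    by (simp add: divide_simps flip: qpoch_mult_qpoch_minus) (simp add: algebra_simps)
  then show "q ^ (k\<^sup>2) * qbinom q (n - k) k * (\<Prod>j = k + 1..n - k. 1 + q ^ j) * s ^ k * x ^ (n - 2 * k)
      = ucoeff q k (n - 2 * k) * s ^ k * x ^ (n - 2 * k)"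
    by simp
qed simp

text \<open>
  The quotient \<open>(-q;q)\<^bsub>n-1\<^esub> / (-q^(n-k);q)\<^sub>k\<close> in the definition of \<open>T\<^sub>n\<close> telescopes to
  \<open>(-q;q)\<^bsub>n-k-1\<^esub>\<close>, which is \<open>(-q;q)\<^bsub>n-k\<^esub>\<close> without its last factor \<open>1 + q^(n-k)\<close>. That factor and
  \<open>1 - q^(n-k)\<close> from \<open>[n-k]\<close> make up the denominator \<open>1 - q^(2(n-k))\<close> of \<open>tcoeff\<close>.
\<close>

lemma qcheb_T_eq_whom:
  assumes "n > 0"
  shows "qcheb_T n x s q = whom n (tcoeff q) x s"
proof -
  have coeff: "q ^ (k\<^sup>2) * (qbracket q n / qbracket q (n - k)) * qbinom q (n - k) k *
      (qpoch (- q) q (n - 1) / (qpoch (- q) q k * qpoch (- (q ^ (n - k))) q k))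
      = tcoeff q k (n - 2 * k)" if k: "k \<le> n div 2" for k
  proof -
    obtain m where m: "n - k = Suc m"
      using k assms by (cases "n - k") auto
    have n: "n - 1 = m + k" and r: "n - 2 * k = Suc m - k" and km: "k + (Suc m - k) = Suc m"
      "2 * k + (Suc m - k) = n" "2 * k + 2 * (Suc m - k) = 2 * Suc m"
      using k m assms by auto
    have split: "qpoch (- q) q (m + k) = qpoch (- q) q m * qpoch (- (q ^ Suc m)) q k"
      using qpoch_add[of "- q" q m k] by (simp add: mult.commute)
    have "qpoch (- (q ^ Suc m)) q k \<noteq> 0"
      using qpoch_minus_nz[of "m + k"] unfolding split by simp
    then have 1: "qpoch (- q) q (m + k) / (qpoch (- q) q k * qpoch (- (q ^ Suc m)) q k)
        = qpoch (- q) q m / qpoch (- q) q k"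
      unfolding split by simp
    have 2: "1 - q ^ (2 * Suc m) = (1 - q ^ Suc m) * (1 + q ^ Suc m)"
      by (simp only: mult_2 power_add) (simp add: algebra_simps)
    have 3: "1 - q ^ (2 * Suc m) \<noteq> 0" "1 - q \<noteq> 0"
      using power_neq_1[of "2 * Suc m"] power_neq_1[of 1] by simp_all
    have 4: "1 - q ^ Suc m \<noteq> 0" "1 + q ^ Suc m \<noteq> 0"
      using 3(1) unfolding 2 by auto
    have 5: "qpoch (q\<^sup>2) (q\<^sup>2) (Suc m) = qpoch q q (Suc m) * (qpoch (- q) q m * (1 + q ^ Suc m))"
      unfolding qpoch_mult_qpoch_minus[symmetric] by (simp add: qpoch_Suc mult.commute)
    have 6: "qbracket q n / qbracket q (Suc m) = (1 - q ^ n) / (1 - q ^ Suc m)"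
      using 3(2) by (simp add: qbracket_def)
    show ?thesis
      unfolding m n r tcoeff_def ucoeff_def qbinom_def km 1 2 5 6
        qpoch_mult_qpoch_minus[symmetric, of _ k]
      using 4 qpoch_q_nz qpoch_minus_nz by (simp add: divide_simps del: power_Suc)
  qed
  show ?thesis
    unfolding qcheb_T_def whom_def atLeast0AtMost
    using assms by (simp only: neq0_conv if_not_P) (intro sum.cong refl, simp only: coeff atMost_iff)
qed

section \<open>Contiguity relations\<close>

text \<open>
  The value \<open>0\<close> for \<open>r = 0\<close>, and for \<open>k = 0\<close> in the next lemma, says that a shifted polynomial has no
  term there. The right-hand sides agree because \<open>1 - q\<^sup>0 = 0\<close>, so the boundary terms of the sums
  need no separate treatment.
\<close>

lemma ucoeff_pred_x:
  assumes "k + r > 0"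
  shows "(case r of 0 \<Rightarrow> 0 | Suc r' \<Rightarrow> ucoeff q k r')
    = ucoeff q k r * (1 - q ^ r) / (1 - q ^ (2 * k + 2 * r))"
proof (cases r)
  case (Suc r')
  have "1 - q ^ (2 * k + 2 * r) \<noteq> 0" "1 - q ^ r \<noteq> 0"
    using power_neq_1[of "2 * k + 2 * r"] power_neq_1[of r] Suc by simp_all
  moreover have "qpoch (q\<^sup>2) (q\<^sup>2) (k + r) = qpoch (q\<^sup>2) (q\<^sup>2) (k + r') * (1 - q ^ (2 * k + 2 * r))"
    by (simp add: Suc qpoch_Suc power_add power_mult power2_eq_square algebra_simps power_mult_distrib)
  moreover have "qpoch q q r = qpoch q q r' * (1 - q ^ r)"
    by (simp add: Suc qpoch_Suc algebra_simps)
  ultimately have "ucoeff q k r' = ucoeff q k r * (1 - q ^ r) / (1 - q ^ (2 * k + 2 * r))"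
    using qpoch_q_nz qpoch_sq_nz by (simp add: ucoeff_def divide_simps)
  then show ?thesis by (simp add: Suc)
qed simp

lemma ucoeff_pred_s:
  assumes "k + r > 0"
  shows "(case k of 0 \<Rightarrow> 0 | Suc k' \<Rightarrow> q ^ (2 * k' + 1) * ucoeff q k' r)
    = ucoeff q k r * (1 - q ^ (2 * k)) / (1 - q ^ (2 * k + 2 * r))"
proof (cases k)
  case (Suc k')
  have "1 - q ^ (2 * k + 2 * r) \<noteq> 0" "1 - q ^ (2 * k) \<noteq> 0"
    using power_neq_1[of "2 * k + 2 * r"] power_neq_1[of "2 * k"] Suc by simp_all
  moreover have "qpoch (q\<^sup>2) (q\<^sup>2) (k + r) = qpoch (q\<^sup>2) (q\<^sup>2) (k' + r) * (1 - q ^ (2 * k + 2 * r))"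
    by (simp add: Suc qpoch_Suc power_add power_mult power2_eq_square algebra_simps power_mult_distrib)
  moreover have "qpoch (q\<^sup>2) (q\<^sup>2) k = qpoch (q\<^sup>2) (q\<^sup>2) k' * (1 - q ^ (2 * k))"
    by (simp add: Suc qpoch_Suc power_mult power2_eq_square algebra_simps power_mult_distrib)
  moreover have "q ^ (k\<^sup>2) = q ^ (2 * k' + 1) * q ^ (k'\<^sup>2)"
    by (simp add: Suc power2_eq_square mult_2 add_ac flip: power_add)
  ultimately have "q ^ (2 * k' + 1) * ucoeff q k' r
      = ucoeff q k r * (1 - q ^ (2 * k)) / (1 - q ^ (2 * k + 2 * r))"
    using qpoch_q_nz qpoch_sq_nz by (simp add: ucoeff_def divide_simps)
  then show ?thesis by (simp add: Suc)
qed simp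

text \<open>
  In each of the following four identities, all terms have the common factor
  \<open>ucoeff q k r / (1 - q ^ (2 * k + 2 * r))\<close>, so that a polynomial identity in \<open>q\<^sup>k\<close> and \<open>q\<^sup>r\<close>
  remains.
\<close>

lemma ucoeff_eq_tcoeff:
  assumes "k + r > 0"
  shows "ucoeff q k r
    = q ^ (2 * k + r) * (case r of 0 \<Rightarrow> 0 | Suc r' \<Rightarrow> ucoeff q k r') + tcoeff q k r"
proof -
  have "1 - q ^ (2 * k + 2 * r) \<noteq> 0" using power_neq_1[of "2 * k + 2 * r"] assms by simp
  then show ?thesis unfolding ucoeff_pred_x[OF assms] tcoeff_def
    by (simp add: divide_simps) (simp add: algebra_simps power_add mult_2 mult_2_right)
qed

lemma ucoeff_eq_tcoeff_shifted:
  assumes "k + r > 0"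
  shows "(q\<^sup>2) ^ k * ucoeff q k r
    = q ^ (2 * k + r) * tcoeff q k r + (case r of 0 \<Rightarrow> 0 | Suc r' \<Rightarrow> (q\<^sup>2) ^ k * ucoeff q k r')"
proof -
  have "1 - q ^ (2 * k + 2 * r) \<noteq> 0" using power_neq_1[of "2 * k + 2 * r"] assms by simp
  then have "(q\<^sup>2) ^ k * ucoeff q k r = q ^ (2 * k + r) * tcoeff q k r
      + (q\<^sup>2) ^ k * (case r of 0 \<Rightarrow> 0 | Suc r' \<Rightarrow> ucoeff q k r')"
    unfolding ucoeff_pred_x[OF assms] tcoeff_def power_mult[symmetric]
    by (simp add: divide_simps) (simp add: algebra_simps power_add mult_2 mult_2_right)
  then show ?thesis by (cases r) simp_all
qed

lemma tcoeff_eq_ucoeff: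
  assumes "k + r > 0"
  shows "tcoeff q k r = (case r of 0 \<Rightarrow> 0 | Suc r' \<Rightarrow> ucoeff q k r')
    + (case k of 0 \<Rightarrow> 0 | Suc k' \<Rightarrow> q ^ (2 * k' + r + 1) * ucoeff q k' r)"
proof -
  have "1 - q ^ (2 * k + 2 * r) \<noteq> 0" using power_neq_1[of "2 * k + 2 * r"] assms by simp
  then have "tcoeff q k r = (case r of 0 \<Rightarrow> 0 | Suc r' \<Rightarrow> ucoeff q k r')
    + q ^ r * (case k of 0 \<Rightarrow> 0 | Suc k' \<Rightarrow> q ^ (2 * k' + 1) * ucoeff q k' r)"
    unfolding ucoeff_pred_x[OF assms] ucoeff_pred_s[OF assms] tcoeff_def
    by (simp add: divide_simps) (simp add: algebra_simps power_add mult_2 mult_2_right)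
  then show ?thesis by (cases k) (simp_all add: power_add algebra_simps)
qed

lemma tcoeff_eq_ucoeff_shifted:
  assumes "k + r > 0"
  shows "tcoeff q k r = (case r of 0 \<Rightarrow> 0 | Suc r' \<Rightarrow> (q\<^sup>2) ^ k * ucoeff q k r')
    + (case k of 0 \<Rightarrow> 0 | Suc k' \<Rightarrow> q * ((q\<^sup>2) ^ k' * ucoeff q k' r))"
proof -
  have "1 - q ^ (2 * k + 2 * r) \<noteq> 0" using power_neq_1[of "2 * k + 2 * r"] assms by simp
  then have "tcoeff q k r = (q\<^sup>2) ^ k * (case r of 0 \<Rightarrow> 0 | Suc r' \<Rightarrow> ucoeff q k r')
    + (case k of 0 \<Rightarrow> 0 | Suc k' \<Rightarrow> q ^ (2 * k' + 1) * ucoeff q k' r)"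
    unfolding ucoeff_pred_x[OF assms] ucoeff_pred_s[OF assms] tcoeff_def power_mult[symmetric]
    by (simp add: divide_simps) (simp add: algebra_simps power_add mult_2 mult_2_right)
  then show ?thesis by (cases k; cases r) (simp_all add: algebra_simps flip: power_mult)
qed

lemma qcheb_U_Suc:
  "qcheb_U (Suc n) x s q = q ^ Suc n * x * qcheb_U n x s q + qcheb_T (Suc n) x s q"
proof -
  have "whom (Suc n) (ucoeff q) x s = whom (Suc n)
      (\<lambda>k r. q ^ Suc n * (case r of 0 \<Rightarrow> 0 | Suc r' \<Rightarrow> ucoeff q k r') + tcoeff q k r) x s"
  proof (rule whom_cong)
    fix k r assume "2 * k + r = Suc n"
    then show "ucoeff q k r
        = q ^ Suc n * (case r of 0 \<Rightarrow> 0 | Suc r' \<Rightarrow> ucoeff q k r') + tcoeff q k r"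
      using ucoeff_eq_tcoeff[of k r] by (cases "k + r > 0") auto
  qed
  then show ?thesis
    by (simp only: qcheb_U_eq_whom qcheb_T_eq_whom[OF zero_less_Suc] mult.assoc[of "q ^ Suc n"]
        whom_mult_x whom_scale[of "q ^ Suc n"] whom_add)
qed

lemma qcheb_U_Suc_shifted:
  "qcheb_U (Suc n) x (q\<^sup>2 * s) q
    = q ^ Suc n * qcheb_T (Suc n) x s q + x * qcheb_U n x (q\<^sup>2 * s) q"
proof -
  have "whom (Suc n) (\<lambda>k r. (q\<^sup>2) ^ k * ucoeff q k r) x s = whom (Suc n) (\<lambda>k r.
      q ^ Suc n * tcoeff q k r + (case r of 0 \<Rightarrow> 0 | Suc r' \<Rightarrow> (q\<^sup>2) ^ k * ucoeff q k r')) x s"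
  proof (rule whom_cong)
    fix k r assume "2 * k + r = Suc n"
    then show "(q\<^sup>2) ^ k * ucoeff q k r
        = q ^ Suc n * tcoeff q k r + (case r of 0 \<Rightarrow> 0 | Suc r' \<Rightarrow> (q\<^sup>2) ^ k * ucoeff q k r')"
      using ucoeff_eq_tcoeff_shifted[of k r] by (cases "k + r > 0") auto
  qed
  then show ?thesis
    by (simp only: qcheb_U_eq_whom qcheb_T_eq_whom[OF zero_less_Suc] whom_scale_arg whom_mult_x
        whom_scale[of "q ^ Suc n"] whom_add)
qed

lemma qcheb_T_Suc_Suc:
  "qcheb_T (Suc (Suc n)) x s q
    = x * qcheb_U (Suc n) x s q + s * (q ^ Suc n * qcheb_U n x s q)"
proof -
  have "whom (Suc (Suc n)) (tcoeff q) x s = whom (Suc (Suc n))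
      (\<lambda>k r. (case r of 0 \<Rightarrow> 0 | Suc r' \<Rightarrow> ucoeff q k r')
        + (case k of 0 \<Rightarrow> 0 | Suc k' \<Rightarrow> q ^ Suc n * ucoeff q k' r)) x s"
  proof (rule whom_cong)
    fix k r assume "2 * k + r = Suc (Suc n)"
    then show "tcoeff q k r = (case r of 0 \<Rightarrow> 0 | Suc r' \<Rightarrow> ucoeff q k r')
        + (case k of 0 \<Rightarrow> 0 | Suc k' \<Rightarrow> q ^ Suc n * ucoeff q k' r)"
      using tcoeff_eq_ucoeff[of k r] by (cases k) auto
  qed
  then show ?thesis
    by (simp only: qcheb_U_eq_whom qcheb_T_eq_whom[OF zero_less_Suc] whom_mult_x whom_mult_s
        whom_scale[of "q ^ Suc n"] whom_add)
qed

lemma qcheb_T_Suc_Suc_shifted: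
  "qcheb_T (Suc (Suc n)) x s q
    = x * qcheb_U (Suc n) x (q\<^sup>2 * s) q + s * (q * qcheb_U n x (q\<^sup>2 * s) q)"
proof -
  have "whom (Suc (Suc n)) (tcoeff q) x s = whom (Suc (Suc n))
      (\<lambda>k r. (case r of 0 \<Rightarrow> 0 | Suc r' \<Rightarrow> (q\<^sup>2) ^ k * ucoeff q k r')
        + (case k of 0 \<Rightarrow> 0 | Suc k' \<Rightarrow> q * ((q\<^sup>2) ^ k' * ucoeff q k' r))) x s"
  proof (rule whom_cong)
    fix k r assume "2 * k + r = Suc (Suc n)"
    then have "k + r > 0" by auto
    then show "tcoeff q k r = (case r of 0 \<Rightarrow> 0 | Suc r' \<Rightarrow> (q\<^sup>2) ^ k * ucoeff q k r')
        + (case k of 0 \<Rightarrow> 0 | Suc k' \<Rightarrow> q * ((q\<^sup>2) ^ k' * ucoeff q k' r))"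
      by (rule tcoeff_eq_ucoeff_shifted)
  qed
  then show ?thesis
    by (simp only: qcheb_U_eq_whom qcheb_T_eq_whom[OF zero_less_Suc] whom_scale_arg whom_mult_x
        whom_mult_s whom_scale[of q] whom_add)
qed

end

section \<open>The matrix product\<close>

lemma mat22_mult:
  fixes a :: "'a::semiring_1"
  shows "mat22 a b c d ** mat22 a' b' c' d'
    = mat22 (a * a' + b * c') (a * b' + b * d') (c * a' + d * c') (c * b' + d * d')"
  by (simp add: mat22_def matrix_matrix_mult_def vec_eq_iff forall_2 sum_2)

lemma mat_prod_Suc: "mat_prod A (Suc n) = mat_prod A n ** A n"
proof -
  have "foldr (**) Bs C = foldr (**) Bs (mat 1) ** C" for Bs :: "('a^'m^'m) list" and C
    by (induction Bs) (simp_all add: matrix_mul_assoc)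
  from this[of "map A [0..<n]" "A n"] show ?thesis
    by (simp add: mat_prod_def)
qed

text \<open>
  The induction starts at one factor, because the entries for the empty product would involve
  \<open>U\<close> with index \<open>-1\<close>.
\<close>

lemma (in not_root_of_unity) mat_prod_V:
  "mat_prod (\<lambda>i. V i x s q) (Suc n)
    = mat22 (qcheb_T (Suc n) x s q) ((x\<^sup>2 + q * s) * qcheb_U n x (q\<^sup>2 * s) q)
            (qcheb_U n x (q * s) q) (qcheb_T (Suc n) x (q * s) q)"
proof (induction n)
  case 0
  have "qcheb_U 0 x s' q = 1" "qcheb_T (Suc 0) x s' q = x" for s'
    using power_neq_1[of 1]
    by (simp_all add: qcheb_U_def qcheb_T_def qbinom_def qbracket_def qpoch_def)
  then show ?case
    by (simp add: mat_prod_def V_def)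
next
  case (Suc n)
  let ?p = "q ^ Suc n"
  \<comment> \<open>The relations for \<open>T\<close> do not contain \<open>T\<^bsub>n+1\<^esub>\<close>; the entries on the diagonal match them once the\<close>
  \<comment> \<open>relations for \<open>U\<close> have replaced the top \<open>U\<close> by \<open>T\<^bsub>n+1\<^esub>\<close> and the preceding \<open>U\<close>.\<close>
  have 1: "qcheb_T (Suc n) x s q * (?p * x) + (x\<^sup>2 + q * s) * qcheb_U n x (q\<^sup>2 * s) q * 1
      = qcheb_T (Suc (Suc n)) x s q"
    unfolding qcheb_T_Suc_Suc_shifted[of n] qcheb_U_Suc_shifted
    by (simp add: algebra_simps power2_eq_square)
  have 2: "qcheb_T (Suc n) x s q * (?p * (x\<^sup>2 + q * s))
      + (x\<^sup>2 + q * s) * qcheb_U n x (q\<^sup>2 * s) q * x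
      = (x\<^sup>2 + q * s) * qcheb_U (Suc n) x (q\<^sup>2 * s) q"
    unfolding qcheb_U_Suc_shifted by (simp only: distrib_left mult_ac)
  have 3: "qcheb_U n x (q * s) q * (?p * x) + qcheb_T (Suc n) x (q * s) q * 1
      = qcheb_U (Suc n) x (q * s) q"
    unfolding qcheb_U_Suc by (simp add: mult_ac)
  have 4: "qcheb_U n x (q * s) q * (?p * (x\<^sup>2 + q * s)) + qcheb_T (Suc n) x (q * s) q * x
      = qcheb_T (Suc (Suc n)) x (q * s) q"
    unfolding qcheb_T_Suc_Suc[of n] qcheb_U_Suc
    by (simp add: algebra_simps power2_eq_square)
  show ?case
    unfolding mat_prod_Suc[of _ "Suc n"] Suc.IH
    unfolding V_def mat22_mult 1 2 3 4 ..
qed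

lemma indet_q_power: "indet_q ^ n = (to_fract [:[:monom 1 n:]:] :: 'k::field ratfun3)"
proof (induction n)
  case (Suc n)
  have "indet_q ^ Suc n
      = to_fract ([:[:[:0, 1:]:]:] * [:[:monom 1 n:]:] :: 'k poly poly poly)"
    by (simp only: to_fract_mult power_Suc Suc) (simp only: indet_q_def)
  also have "[:[:[:0, 1:]:]:] * [:[:monom 1 n:]:] = [:[:monom (1::'k) (Suc n):]:]"
    by (simp add: monom_Suc)
  finally show ?case .
qed (simp flip: one_pCons)

lemma not_root_of_unity_indet_q: "not_root_of_unity (indet_q :: 'k::field ratfun3)"
proof
  fix n :: nat assume "n > 0"
  show "(indet_q :: 'k ratfun3) ^ n \<noteq> 1"
  proof
    assume "(indet_q :: 'k ratfun3) ^ n = 1"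
    then have "to_fract [:[:monom (1::'k) n:]:] = to_fract 1"
      by (simp add: indet_q_power)
    then have "[:[:monom (1::'k) n:]:] = 1"
      by (simp only: to_fract_eq_iff)
    then have "monom (1::'k) n = 1"
      by (simp add: one_pCons)
    then show False
      using \<open>n > 0\<close> degree_monom_eq[of "1::'k" n] by simp
  qed
qed

theorem theorem5p5:
  fixes x s q :: "'k::field ratfun3" and n :: nat
  defines "x \<equiv> indet_x" and "s \<equiv> indet_s" and "q \<equiv> indet_q"
  assumes "n \<ge> 1"
  shows "mat22 (qcheb_T n x s q) ((x\<^sup>2 + q * s) * qcheb_U (n - 1) x (q\<^sup>2 * s) q)
               (qcheb_U (n - 1) x (q * s) q) (qcheb_T n x (q * s) q)
         = mat_prod (\<lambda>i. V i x s q) n"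
proof -
  interpret not_root_of_unity q
    unfolding q_def by (rule not_root_of_unity_indet_q)
  from assms(4) obtain m where "n = Suc m" by (cases n) auto
  then show ?thesis by (simp add: mat_prod_V)
qed

end
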